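(* Let $r\ge 3$, let $B$ be a weakly reduced basis of the free group $F_r$, and let $w\in B$. Then $w$ does not contain any primitivity-blocking subwords.
   Context: $F_r$ is the free group of rank $r$ with fixed basis $x_1,\dots,x_r$; elements are identified with freely reduced words in the letters $x_i^{\pm1}$, and subwords (contiguous) refer to these reduced words. A basis of $F_r$ means a free generating set. A basis $B$ is weakly reduced if there is no letter $p\in\{x_1^{\pm1},\dots,x_r^{\pm1}\}$ such that every element of $B$ begins with $p$ and ends with $p^{-1}$. An element $u\in F_r$ is primitive if some automorphism of $F_r$ takes $x_1$ to $u$. A word $v$ is primitivity-blocking if for every $\varphi\in\operatorname{Aut}(F_r)$, $v$ is not a subword of the cyclic reduction of $\varphi(x_1)$; equivalently, $v$ is not a subword of any cyclically reduced primitive element of $F_r$. *)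

theory Defs
  imports "HOL-Algebra.Group" "HOL-Library.Sublist"
begin

text \<open>The letter \<open>(a, True)\<close> stands for the generator \<open>a\<close> and \<open>(a, False)\<close> for its inverse.\<close>

type_synonym 'a letter = "'a \<times> bool"

definition inv_letter :: "'a letter \<Rightarrow> 'a letter" where
  "inv_letter p = (fst p, \<not> snd p)"

definition freely_reduced :: "'a letter list \<Rightarrow> bool" where
  "freely_reduced = successively (\<lambda>p q. q \<noteq> inv_letter p)"

fun cancel_Cons :: "'a letter \<Rightarrow> 'a letter list \<Rightarrow> 'a letter list" where
  "cancel_Cons p [] = [p]"
| "cancel_Cons p (q # w) = (if q = inv_letter p then w else p # q # w)"

definition free_reduction :: "'a letter list \<Rightarrow> 'a letter list" where
  "free_reduction w = foldr cancel_Cons w []"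

definition free_group :: "'a set \<Rightarrow> 'a letter list monoid" where
  "free_group X =
     \<lparr>carrier = {w. freely_reduced w \<and> fst ` set w \<subseteq> X},
      mult = (\<lambda>u v. free_reduction (u @ v)),
      one = []\<rparr>"

abbreviation free_group_rank :: "nat \<Rightarrow> nat letter list monoid" where
  "free_group_rank r \<equiv> free_group {1..r}"

definition word_value :: "('a, 'm) monoid_scheme \<Rightarrow> 'a letter list \<Rightarrow> 'a" where
  "word_value G w =
     foldr (\<lambda>p g. (if snd p then fst p else inv\<^bsub>G\<^esub> (fst p)) \<otimes>\<^bsub>G\<^esub> g) w \<one>\<^bsub>G\<^esub>"

text \<open>
  \<open>B\<close> is a free generating set of \<open>G\<close> if the homomorphism from the free group on the set \<open>B\<close>
  to \<open>G\<close> that extends the inclusion of \<open>B\<close> is an isomorphism. Here the letters of the free group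
  are themselves (signed) elements of \<open>G\<close>.
\<close>

definition free_basis :: "('a, 'm) monoid_scheme \<Rightarrow> 'a set \<Rightarrow> bool" where
  "free_basis G B \<longleftrightarrow> B \<subseteq> carrier G \<and> word_value G \<in> iso (free_group B) G"

definition weakly_reduced :: "nat \<Rightarrow> nat letter list set \<Rightarrow> bool" where
  "weakly_reduced r B \<longleftrightarrow>
     \<not> (\<exists>p \<in> {1..r} \<times> UNIV. \<forall>b \<in> B. prefix [p] b \<and> suffix [inv_letter p] b)"

fun cyclic_reduction :: "'a letter list \<Rightarrow> 'a letter list" where
  "cyclic_reduction w =
     (if w \<noteq> [] \<and> last w = inv_letter (hd w) then cyclic_reduction (butlast (tl w)) else w)"

declare cyclic_reduction.simps [simp del]

text \<open>
  Words are elements of the free group, hence freely reduced. \<open>sublist\<close> is the contiguous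
  subword relation, and \<open>[(1, True)]\<close> is the first basis element.
\<close>

definition primitivity_blocking :: "nat \<Rightarrow> nat letter list \<Rightarrow> bool" where
  "primitivity_blocking r v \<longleftrightarrow>
     v \<in> carrier (free_group_rank r) \<and>
     (\<forall>\<phi> \<in> iso (free_group_rank r) (free_group_rank r).
        \<not> sublist v (cyclic_reduction (\<phi> [(1, True)])))"

end

theory Submission imports Defs begin

text \<open>
  If \<open>w\<close> is cyclically reduced, it is itself a cyclically reduced primitive element. Otherwise
  \<open>w\<close> begins with some letter \<open>p\<close> and ends with \<open>p\<inverse>\<close>, and it suffices to complete \<open>w\<close> to a
  basis containing an element \<open>d\<close> that neither begins with \<open>p\<close> nor ends with \<open>p\<inverse>\<close>: then \<open>w d\<close> is
  primitive, reduced and cyclically reduced as it stands. Weak reducedness provides, up to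
  inversion, a basis element \<open>v\<close> that does not begin with \<open>p\<close>. If \<open>v\<close> ends with \<open>p\<inverse>\<close>, it is
  cyclically reduced, so replacing a third basis element \<open>c\<close> by \<open>v\<^sup>k c\<close> with \<open>k\<close> large gives another
  element that does not begin with \<open>p\<close>. If that one also ends with \<open>p\<inverse>\<close>, then a Euclidean
  algorithm on the common suffixes of the two elements yields \<open>d\<close>.
\<close>

section \<open>The group of reduced words\<close>

lemma inv_letter_inv_letter [simp]: "inv_letter (inv_letter p) = p"
  by (simp add: inv_letter_def)

lemma inv_letter_eq_iff [simp]: "inv_letter p = inv_letter q \<longleftrightarrow> p = q"
  by (metis inv_letter_inv_letter)

lemma fst_inv_letter [simp]: "fst (inv_letter p) = fst p"
  by (simp add: inv_letter_def)

lemma freely_reduced_Nil [simp]: "freely_reduced []"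
  by (simp add: freely_reduced_def)

lemma freely_reduced_singleton [simp]: "freely_reduced [p]"
  by (simp add: freely_reduced_def)

lemma freely_reduced_Cons:
  "freely_reduced (p # w) \<longleftrightarrow> freely_reduced w \<and> (w = [] \<or> hd w \<noteq> inv_letter p)"
  by (auto simp: freely_reduced_def successively_Cons)

lemma freely_reduced_append:
  "freely_reduced (u @ v) \<longleftrightarrow>
     freely_reduced u \<and> freely_reduced v \<and> (u = [] \<or> v = [] \<or> hd v \<noteq> inv_letter (last u))"
  by (auto simp: freely_reduced_def successively_append_iff)

lemma freely_reduced_cancel_Cons:
  "freely_reduced w \<Longrightarrow> freely_reduced (cancel_Cons p w)"
  by (cases w) (auto simp: freely_reduced_Cons)

text \<open>Reducedness matters when \<open>w\<close> begins with \<open>p\<close>: once that letter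
  is removed, the rest cannot begin with the inverse of \<open>p\<close>, so the outer step puts
  \<open>p\<close> back instead of cancelling again.\<close>

lemma cancel_Cons_inv:
  "freely_reduced w \<Longrightarrow> cancel_Cons p (cancel_Cons (inv_letter p) w) = w"
proof (cases w)
  case (Cons q v)
  assume "freely_reduced w"
  then show ?thesis using Cons by (cases v) (auto simp: freely_reduced_Cons)
qed simp

lemma cancel_Cons_id: "freely_reduced (p # w) \<Longrightarrow> cancel_Cons p w = p # w"
  by (cases w) (auto simp: freely_reduced_Cons)

text \<open>A word acts on the reduced words by \<open>cancel_Cons\<close>; the value at the empty word recovers
  the free reduction, and all of the group laws follow from properties of this action.\<close>

abbreviation act :: "'a letter list \<Rightarrow> 'a letter list \<Rightarrow> 'a letter list" where
  "act u w \<equiv> foldr cancel_Cons u w"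

lemma freely_reduced_act: "freely_reduced w \<Longrightarrow> freely_reduced (act u w)"
  by (induction u) (auto simp: freely_reduced_cancel_Cons)

lemma act_id: "freely_reduced (u @ w) \<Longrightarrow> act u w = u @ w"
proof (induction u)
  case (Cons p u)
  then have "freely_reduced (u @ w)" by (auto simp: freely_reduced_Cons)
  with Cons show ?case by (simp add: cancel_Cons_id)
qed simp

text \<open>If \<open>p\<close> cancels the first letter of \<open>u\<close>, the two letters act on
  reduced words as mutually inverse maps.\<close>

lemma act_cancel_Cons:
  assumes "freely_reduced w"
  shows "act (cancel_Cons p u) w = cancel_Cons p (act u w)"
proof (cases u)
  case (Cons q v)
  have "cancel_Cons p (cancel_Cons (inv_letter p) (act v w)) = act v w"
    using cancel_Cons_inv freely_reduced_act[OF assms] by blast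
  then show ?thesis using Cons by auto
qed simp

lemma free_reduction_id: "freely_reduced u \<Longrightarrow> free_reduction u = u"
  using act_id[of u "[]"] by (simp add: free_reduction_def)

text \<open>Products are free reductions of concatenations, so this turns associativity into
  composition of actions.\<close>

lemma act_free_reduction: "freely_reduced w \<Longrightarrow> act (free_reduction u) w = act u w"
  by (induction u) (auto simp: free_reduction_def act_cancel_Cons)

lemma free_reduction_append: "freely_reduced v \<Longrightarrow> free_reduction (u @ v) = act u v"
  using free_reduction_id[of v] by (simp add: free_reduction_def)

lemma set_cancel_Cons: "set (cancel_Cons p w) \<subseteq> insert p (set w)"
  by (cases w) auto

lemma fst_set_act:
  assumes "fst ` set u \<subseteq> X" "fst ` set w \<subseteq> X"
  shows "fst ` set (act u w) \<subseteq> X"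
proof -
  have "set (act u w) \<subseteq> set u \<union> set w"
    by (induction u) (use set_cancel_Cons in fastforce)+
  then show ?thesis using assms by blast
qed

text \<open>Each letter of \<open>c\<close> cancels at most one letter at the end of
  \<open>u\<close>, so a word longer than \<open>c\<close> keeps its first letter. The induction
  strips one cancelling pair at a time.\<close>

lemma hd_act:
  assumes "freely_reduced u" "freely_reduced c" "length c < length u"
  shows "act u c \<noteq> [] \<and> hd (act u c) = hd u"
  using assms
proof (induction c arbitrary: u)
  case Nil
  then show ?case using act_id[of u "[]"] by auto
next
  case (Cons q c)
  then obtain v s where u: "u = v @ [s]" by (cases u rule: rev_cases) auto
  show ?case
  proof (cases "q = inv_letter s")
    case True
    have "act v c \<noteq> [] \<and> hd (act v c) = hd v"
      using Cons u by (auto simp: freely_reduced_append freely_reduced_Cons)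
    then show ?thesis using True u Cons.prems by (cases v) auto
  next
    case False
    have "freely_reduced (u @ (q # c))"
      using Cons.prems False u by (auto simp: freely_reduced_append freely_reduced_Cons)
    then show ?thesis using act_id u by (cases v) fastforce+
  qed
qed

section \<open>Inverse words and the group laws\<close>

definition inv_word :: "'a letter list \<Rightarrow> 'a letter list" where
  "inv_word w = map inv_letter (rev w)"

lemma inv_word_simps [simp]:
  "inv_word [] = []" "inv_word (p # w) = inv_word w @ [inv_letter p]"
  "inv_word (u @ v) = inv_word v @ inv_word u" "inv_word w = [] \<longleftrightarrow> w = []"
  by (auto simp: inv_word_def)

lemma hd_inv_word: "w \<noteq> [] \<Longrightarrow> hd (inv_word w) = inv_letter (last w)"
  by (cases w rule: rev_cases) auto

lemma last_inv_word: "w \<noteq> [] \<Longrightarrow> last (inv_word w) = inv_letter (hd w)"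
  by (cases w) auto

lemma set_inv_word: "fst ` set (inv_word w) = fst ` set w"
  by (simp add: inv_word_def image_image)

lemma freely_reduced_inv_word: "freely_reduced w \<Longrightarrow> freely_reduced (inv_word w)"
  by (induction w) (auto simp: freely_reduced_append freely_reduced_Cons last_inv_word)

lemma act_inv_word: "freely_reduced v \<Longrightarrow> act (inv_word u) (act u v) = v"
proof (induction u arbitrary: v)
  case (Cons p u)
  then show ?case
    using cancel_Cons_inv[of "act u v" "inv_letter p"] by (simp add: freely_reduced_act)
qed simp

lemma free_group_simps:
  "w \<in> carrier (free_group X) \<longleftrightarrow> freely_reduced w \<and> fst ` set w \<subseteq> X"
  "\<one>\<^bsub>free_group X\<^esub> = []"
  by (auto simp: free_group_def)

lemma mult_free_group:
  "v \<in> carrier (free_group X) \<Longrightarrow> u \<otimes>\<^bsub>free_group X\<^esub> v = act u v"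
  by (simp add: free_group_def free_reduction_append)

lemma mult_free_group_append:
  "freely_reduced (u @ v) \<Longrightarrow> u \<otimes>\<^bsub>free_group X\<^esub> v = u @ v"
  by (simp add: free_group_def free_reduction_id)

lemma act_closed:
  assumes "u \<in> carrier (free_group X)" "v \<in> carrier (free_group X)"
  shows "act u v \<in> carrier (free_group X)"
  using assms fst_set_act[of u X v] by (simp add: free_group_simps freely_reduced_act)

lemma inv_word_closed:
  "u \<in> carrier (free_group X) \<Longrightarrow> inv_word u \<in> carrier (free_group X)"
  by (simp add: free_group_simps freely_reduced_inv_word set_inv_word)

lemma group_free_group: "group (free_group X)"
proof (rule groupI)
  fix u v w
  assume u: "u \<in> carrier (free_group X)" and v: "v \<in> carrier (free_group X)"
    and w: "w \<in> carrier (free_group X)"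
  have "act (act u v) w = act (free_reduction (u @ v)) w"
    using v by (simp add: free_reduction_append free_group_simps)
  also have "\<dots> = act u (act v w)"
    using w by (simp add: act_free_reduction free_group_simps)
  finally show "u \<otimes>\<^bsub>free_group X\<^esub> v \<otimes>\<^bsub>free_group X\<^esub> w =
      u \<otimes>\<^bsub>free_group X\<^esub> (v \<otimes>\<^bsub>free_group X\<^esub> w)"
    using u v w by (simp add: mult_free_group act_closed)
next
  fix u assume u: "u \<in> carrier (free_group X)"
  then have "act u [] = u" by (simp add: act_id free_group_simps)
  then have "act (inv_word u) u = []" using act_inv_word[of "[]" u] by simp
  then show "\<exists>v\<in>carrier (free_group X). v \<otimes>\<^bsub>free_group X\<^esub> u = \<one>\<^bsub>free_group X\<^esub>"
    using u by (metis inv_word_closed free_group_simps(2) mult_free_group)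
qed (auto simp: mult_free_group act_closed free_group_simps(2), auto simp: free_group_simps)

lemma inv_free_group:
  assumes u: "u \<in> carrier (free_group X)"
  shows "inv\<^bsub>free_group X\<^esub> u = inv_word u"
proof -
  interpret group "free_group X" by (rule group_free_group)
  have "act u [] = u" using u by (simp add: act_id free_group_simps)
  then have "inv_word u \<otimes>\<^bsub>free_group X\<^esub> u = \<one>\<^bsub>free_group X\<^esub>"
    using u act_inv_word[of "[]" u] by (simp add: mult_free_group free_group_simps(2))
  then show ?thesis using u inv_word_closed by (metis inv_equality)
qed

section \<open>The universal property\<close>

definition lift :: "('b, 'm) monoid_scheme \<Rightarrow> ('a \<Rightarrow> 'b) \<Rightarrow> 'a letter list \<Rightarrow> 'b" where
  "lift G f w =
     foldr (\<lambda>p g. (if snd p then f (fst p) else inv\<^bsub>G\<^esub> f (fst p)) \<otimes>\<^bsub>G\<^esub> g) w \<one>\<^bsub>G\<^esub>"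

lemma word_value_eq_lift: "word_value G = lift G (\<lambda>x. x)"
  by (simp add: fun_eq_iff word_value_def lift_def)

abbreviation gen :: "'a \<Rightarrow> 'a letter list" where
  "gen x \<equiv> [(x, True)]"

lemma gen_closed: "x \<in> X \<Longrightarrow> gen x \<in> carrier (free_group X)"
  by (simp add: free_group_simps)

context group
begin

lemma lift_closed:
  "f \<in> X \<rightarrow> carrier G \<Longrightarrow> fst ` set w \<subseteq> X \<Longrightarrow> lift G f w \<in> carrier G"
  by (induction w) (auto simp: lift_def)

lemma lift_gen: "f x \<in> carrier G \<Longrightarrow> lift G f (gen x) = f x"
  by (simp add: lift_def)

lemma lift_Cons:
  "lift G f (p # w) = (if snd p then f (fst p) else inv f (fst p)) \<otimes> lift G f w"
  by (simp add: lift_def)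

text \<open>A cancelling pair contributes two mutually inverse factors to the value in
  \<open>G\<close>.\<close>

lemma lift_cancel_Cons:
  assumes "f \<in> X \<rightarrow> carrier G" "fst ` set w \<subseteq> X" "fst p \<in> X"
  shows "lift G f (cancel_Cons p w) = lift G f (p # w)"
proof (cases w)
  case (Cons q v)
  have "lift G f v \<in> carrier G" "f (fst p) \<in> carrier G"
    using assms Cons lift_closed[of f X v] by auto
  then show ?thesis
    using Cons by (auto simp: lift_Cons inv_letter_def m_assoc[symmetric])
qed simp

lemma lift_act:
  assumes "f \<in> X \<rightarrow> carrier G" "fst ` set u \<subseteq> X" "fst ` set v \<subseteq> X"
  shows "lift G f (act u v) = lift G f u \<otimes> lift G f v"
  using assms(2)
proof (induction u)
  case Nil
  then show ?case using lift_closed[OF assms(1,3)] by (simp add: lift_def)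
next
  case (Cons p u)
  then have "fst ` set (act u v) \<subseteq> X" using fst_set_act[of u X v] assms(3) by simp
  moreover have "lift G f u \<in> carrier G" "lift G f v \<in> carrier G" "f (fst p) \<in> carrier G"
    using Cons.prems assms lift_closed[of f X] by auto
  ultimately show ?case
    using Cons assms(1) by (auto simp: lift_cancel_Cons[of f X] lift_Cons m_assoc)
qed

lemma lift_hom:
  assumes "f \<in> X \<rightarrow> carrier G"
  shows "lift G f \<in> hom (free_group X) G"
proof (rule homI)
  fix u v assume "u \<in> carrier (free_group X)" "v \<in> carrier (free_group X)"
  then show "lift G f (u \<otimes>\<^bsub>free_group X\<^esub> v) = lift G f u \<otimes> lift G f v"
    by (subst mult_free_group) (auto simp: free_group_simps intro: lift_act[OF assms])
qed (auto simp: free_group_simps lift_closed[OF assms])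

lemma lift_unique:
  assumes h: "h \<in> hom (free_group X) G" and "w \<in> carrier (free_group X)"
  shows "h w = lift G (\<lambda>x. h (gen x)) w"
  using assms(2)
proof (induction w)
  interpret h: group_hom "free_group X" G h
    using h group_free_group is_group by (simp add: group_hom_def group_hom_axioms_def)
  {
    case Nil
    then show ?case using h.hom_one by (simp add: lift_def free_group_simps)
  next
    case (Cons p w)
    have w: "w \<in> carrier (free_group X)" and p: "fst p \<in> X"
      using Cons.prems by (auto simp: free_group_simps freely_reduced_Cons)
    have "[p] = (if snd p then gen (fst p) else inv\<^bsub>free_group X\<^esub> gen (fst p))"
      using gen_closed[OF p] by (cases p) (auto simp: inv_free_group inv_letter_def)
    then have hp: "h [p] = (if snd p then h (gen (fst p)) else inv h (gen (fst p)))"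
      using gen_closed[OF p] h.hom_inv by (metis (full_types))
    have "p # w = [p] \<otimes>\<^bsub>free_group X\<^esub> w"
      using Cons.prems mult_free_group_append[of "[p]" w] by (simp add: free_group_simps)
    moreover have "[p] \<in> carrier (free_group X)" using p by (simp add: free_group_simps)
    ultimately have "h (p # w) = h [p] \<otimes> h w" using w by simp
    then show ?case using hp Cons.IH w by (simp add: lift_Cons)
  }
qed

lemma hom_free_group_eqI:
  assumes "h \<in> hom (free_group X) G" "k \<in> hom (free_group X) G"
    and "\<And>x. x \<in> X \<Longrightarrow> h (gen x) = k (gen x)" and "w \<in> carrier (free_group X)"
  shows "h w = k w"
proof -
  have "lift G (\<lambda>x. h (gen x)) w = lift G (\<lambda>x. k (gen x)) w"
    using assms(3,4) unfolding lift_def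
    by (intro foldr_cong) (auto simp: free_group_simps)
  then show ?thesis using assms lift_unique by metis
qed

end

text \<open>Both composites of the two lifts fix the generators, and homomorphisms that agree on
  generators are equal, so the lifts are mutually inverse.\<close>

lemma lift_iso:
  assumes f: "f \<in> X \<rightarrow> carrier (free_group Y)" and g: "g \<in> Y \<rightarrow> carrier (free_group X)"
    and fg: "\<And>y. y \<in> Y \<Longrightarrow> lift (free_group Y) f (g y) = gen y"
    and gf: "\<And>x. x \<in> X \<Longrightarrow> lift (free_group X) g (f x) = gen x"
  shows "lift (free_group Y) f \<in> iso (free_group X) (free_group Y)"
proof -
  let ?F = "lift (free_group Y) f" and ?G = "lift (free_group X) g"
  interpret X: group "free_group X" by (rule group_free_group)
  interpret Y: group "free_group Y" by (rule group_free_group)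
  have F: "?F \<in> hom (free_group X) (free_group Y)" by (rule Y.lift_hom[OF f])
  have G: "?G \<in> hom (free_group Y) (free_group X)" by (rule X.lift_hom[OF g])
  have FG: "?F (?G w) = w" if "w \<in> carrier (free_group Y)" for w
  proof -
    have "(?F \<circ> ?G) w = (\<lambda>x. x) w"
    proof (rule Y.hom_free_group_eqI[OF hom_compose[OF G F] _ _ that])
      show "(?F \<circ> ?G) (gen y) = gen y" if "y \<in> Y" for y
        using fg[OF that] X.lift_gen[of g y] funcset_mem[OF g that] by simp
    qed (simp add: hom_def)
    then show ?thesis by simp
  qed
  have GF: "?G (?F w) = w" if "w \<in> carrier (free_group X)" for w
  proof -
    have "(?G \<circ> ?F) w = (\<lambda>x. x) w"
    proof (rule X.hom_free_group_eqI[OF hom_compose[OF F G] _ _ that])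
      show "(?G \<circ> ?F) (gen x) = gen x" if "x \<in> X" for x
        using gf[OF that] Y.lift_gen[of f x] funcset_mem[OF f that] by simp
    qed (simp add: hom_def)
    then show ?thesis by simp
  qed
  have "bij_betw ?F (carrier (free_group X)) (carrier (free_group Y))"
    by (rule bij_betw_byWitness[where f' = ?G])
      (use FG GF hom_in_carrier[OF F] hom_in_carrier[OF G] in auto)
  then show ?thesis using F by (simp add: iso_def)
qed


section \<open>Invariance of the rank\<close>

text \<open>The group of order two: truth values under exclusive or. Each element is its own
  inverse, so the signs of letters do not affect lifts into it.\<close>

definition parity_group :: "bool monoid" where
  "parity_group = \<lparr>carrier = UNIV, mult = (\<noteq>), one = False\<rparr>"

lemma group_parity_group: "group parity_group"
  by (rule groupI) (auto simp: parity_group_def)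

text \<open>Homomorphisms from the free group on \<open>X\<close> to the group of order two correspond to the
  subsets of \<open>X\<close>, so an isomorphism induces a bijection between the power sets.\<close>

lemma card_eq_if_iso_free_group:
  assumes h: "h \<in> iso (free_group Y) (free_group X)" and X: "finite X"
  shows "finite Y \<and> card Y = card X"
proof -
  \<comment> \<open>The value at a word is the parity of the number of its letters whose generator
    lies in \<open>S\<close>.\<close>
  let ?\<chi> = "\<lambda>S. lift parity_group (\<lambda>x. x \<in> S)"
  \<comment> \<open>Pull back the homomorphism given by \<open>S\<close> along \<open>h\<close>, and
    read off the corresponding subset of \<open>Y\<close>.\<close>
  define \<Phi> where "\<Phi> S = {y \<in> Y. ?\<chi> S (h (gen y))}" for S
  interpret P: group parity_group by (rule group_parity_group)
  have \<chi>: "?\<chi> S \<in> hom (free_group Z) parity_group" for S and Z :: "'c set"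
    by (rule P.lift_hom) (simp add: parity_group_def)
  have \<chi>_gen: "?\<chi> S (gen x) \<longleftrightarrow> x \<in> S" for S and x :: 'c
    by (rule P.lift_gen) (simp add: parity_group_def)
  have h_hom: "h \<in> hom (free_group Y) (free_group X)"
    and h_bij: "bij_betw h (carrier (free_group Y)) (carrier (free_group X))"
    using h by (auto simp: iso_def)
  have "inj_on \<Phi> (Pow X)"
  proof (rule inj_onI)
    fix S T assume ST: "S \<in> Pow X" "T \<in> Pow X" "\<Phi> S = \<Phi> T"
    have gens: "?\<chi> S (h (gen y)) = ?\<chi> T (h (gen y))" if "y \<in> Y" for y
      using that ST(3) unfolding \<Phi>_def by blast
    have all: "(?\<chi> S \<circ> h) u = (?\<chi> T \<circ> h) u" if "u \<in> carrier (free_group Y)" for u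
      by (rule P.hom_free_group_eqI[OF hom_compose[OF h_hom \<chi>] hom_compose[OF h_hom \<chi>] _ that])
        (simp add: gens)
    have "?\<chi> S v = ?\<chi> T v" if "v \<in> carrier (free_group X)" for v
    proof -
      have "v \<in> h ` carrier (free_group Y)"
        using that bij_betw_imp_surj_on[OF h_bij] by simp
      then obtain u where u: "v = h u" "u \<in> carrier (free_group Y)" by (rule imageE)
      show ?thesis using all[OF u(2)] u(1) by simp
    qed
    then have "x \<in> S \<longleftrightarrow> x \<in> T" if "x \<in> X" for x
      using gen_closed[OF that] \<chi>_gen by metis
    then show "S = T" using ST by auto
  qed
  moreover have "\<Phi> ` Pow X = Pow Y"
  proof (intro subset_antisym subsetI)
    fix T assume T: "T \<in> Pow Y"
    \<comment> \<open>A preimage of \<open>T\<close> is found by pulling its homomorphism back along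
      the inverse of \<open>h\<close>.\<close>
    define k where "k = ?\<chi> T \<circ> inv_into (carrier (free_group Y)) h"
    define S where "S = {x \<in> X. k (gen x)}"
    have "inv_into (carrier (free_group Y)) h \<in> hom (free_group X) (free_group Y)"
      using group.iso_set_sym[OF group_free_group h] by (simp add: iso_def)
    then have k: "k \<in> hom (free_group X) parity_group"
      unfolding k_def by (rule hom_compose[OF _ \<chi>])
    have "?\<chi> S (gen x) = k (gen x)" if "x \<in> X" for x
      using that unfolding \<chi>_gen by (simp add: S_def)
    then have "?\<chi> S v = k v" if "v \<in> carrier (free_group X)" for v
      using P.hom_free_group_eqI[OF \<chi> k _ that] by simp
    then have "?\<chi> S (h (gen y)) \<longleftrightarrow> y \<in> T" if "y \<in> Y" for y
      using gen_closed[OF that] h_bij \<chi>_gen hom_in_carrier[OF h_hom]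
      by (simp add: k_def bij_betw_def)
    then have "\<Phi> S = T" using T by (auto simp: \<Phi>_def)
    then show "T \<in> \<Phi> ` Pow X" by (auto simp: S_def)
  qed (auto simp: \<Phi>_def)
  ultimately have bij: "bij_betw \<Phi> (Pow X) (Pow Y)" by (simp add: bij_betw_def)
  then have Y: "finite Y" using X bij_betw_finite by blast
  have "(2::nat) ^ card X = 2 ^ card Y"
    using bij_betw_same_card[OF bij] X Y by (simp add: card_Pow)
  then show ?thesis using Y by simp
qed

section \<open>Nielsen moves\<close>

text \<open>The inverse divides by \<open>gen j\<close> instead. The factors cancel because
  \<open>i \<noteq> j\<close> makes both maps fix \<open>gen j\<close>.\<close>

lemma transvection_iso:
  assumes "i \<in> X" "j \<in> X" "i \<noteq> j"
  shows "lift (free_group X) ((\<lambda>x. gen x)(i := gen i \<otimes>\<^bsub>free_group X\<^esub> gen j))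
           \<in> iso (free_group X) (free_group X)"
proof -
  interpret group "free_group X" by (rule group_free_group)
  let ?f = "(\<lambda>x. gen x)(i := gen i \<otimes>\<^bsub>free_group X\<^esub> gen j)"
  let ?g = "(\<lambda>x. gen x)(i := gen i \<otimes>\<^bsub>free_group X\<^esub> inv\<^bsub>free_group X\<^esub> gen j)"
  note [simp] = gen_closed assms m_assoc
  have f: "?f \<in> X \<rightarrow> carrier (free_group X)" and g: "?g \<in> X \<rightarrow> carrier (free_group X)"
    by auto
  interpret f: group_hom "free_group X" "free_group X" "lift (free_group X) ?f"
    by unfold_locales (rule lift_hom[OF f])
  interpret g: group_hom "free_group X" "free_group X" "lift (free_group X) ?g"
    by unfold_locales (rule lift_hom[OF g])
  show ?thesis
    by (rule lift_iso[OF f g]) (use assms not_sym[OF assms(3)] in \<open>auto simp: lift_gen\<close>)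
qed

lemma inversion_iso:
  assumes "i \<in> X"
  shows "lift (free_group X) ((\<lambda>x. gen x)(i := inv\<^bsub>free_group X\<^esub> gen i))
           \<in> iso (free_group X) (free_group X)"
proof -
  interpret group "free_group X" by (rule group_free_group)
  let ?f = "(\<lambda>x. gen x)(i := inv\<^bsub>free_group X\<^esub> gen i)"
  note [simp] = gen_closed assms
  have f: "?f \<in> X \<rightarrow> carrier (free_group X)" by auto
  interpret f: group_hom "free_group X" "free_group X" "lift (free_group X) ?f"
    by unfold_locales (rule lift_hom[OF f])
  show ?thesis
    by (rule lift_iso[OF f f]) (auto simp: lift_gen)
qed

text \<open>Serves both to permute the standard generators and to pass to the free group whose
  generators are the elements of a given basis.\<close>

lemma relabelling_iso:
  assumes "bij_betw \<beta> X Y"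
  shows "lift (free_group Y) (\<lambda>x. gen (\<beta> x)) \<in> iso (free_group X) (free_group Y)"
proof -
  interpret X: group "free_group X" by (rule group_free_group)
  interpret Y: group "free_group Y" by (rule group_free_group)
  have mem: "\<beta> x \<in> Y" if "x \<in> X" for x using assms that by (auto simp: bij_betw_def)
  have mem': "inv_into X \<beta> y \<in> X" if "y \<in> Y" for y
    using assms that by (auto simp: bij_betw_def inv_into_into)
  show ?thesis
    by (rule lift_iso[where g = "\<lambda>y. gen (inv_into X \<beta> y)"])
      (use assms in \<open>auto simp: gen_closed mem mem' X.lift_gen Y.lift_gen
         bij_betw_inv_into_left bij_betw_inv_into_right\<close>)
qed

text \<open>Otherwise the simplifier rewrites the \<open>1\<close> hidden in \<open>free_group_rank r\<close>, and the facts of the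
  interpreted group locale no longer match.\<close>

declare One_nat_def [simp del]

section \<open>Triples that extend to a basis\<close>

text \<open>The first place holds the image of \<open>gen 1\<close>, the primitive element of
  interest; the other two give room for Nielsen moves. Any further basis elements stay hidden in the
  automorphism.\<close>

definition basis_triple ::
    "nat \<Rightarrow> nat letter list \<Rightarrow> nat letter list \<Rightarrow> nat letter list \<Rightarrow> bool" where
  "basis_triple r u v w \<longleftrightarrow>
     (\<exists>\<phi> \<in> iso (free_group_rank r) (free_group_rank r).
        \<phi> (gen 1) = u \<and> \<phi> (gen 2) = v \<and> \<phi> (gen 3) = w)"

text \<open>Invariance of the rank gives \<open>card B = r\<close>, so the standard generators can
  be matched with \<open>B\<close>, the first three going to \<open>u\<close>, \<open>v\<close>,
  \<open>w\<close>. Relabelling followed by evaluation in the group is the automorphism.\<close>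

lemma basis_triple_of_free_basis:
  assumes r: "r \<ge> 3" and B: "free_basis (free_group_rank r) B"
    and "u \<in> B" "v \<in> B" "w \<in> B" "u \<noteq> v" "u \<noteq> w" "v \<noteq> w"
  shows "basis_triple r u v w"
proof -
  interpret group "free_group_rank r" by (rule group_free_group)
  have BF: "B \<subseteq> carrier (free_group_rank r)"
    and h: "word_value (free_group_rank r) \<in> iso (free_group B) (free_group_rank r)"
    using B by (auto simp: free_basis_def)
  have B': "finite B" "card B = r" using card_eq_if_iso_free_group[OF h] by auto
  have "card {4..r} = card (B - {u, v, w})"
    using r B' assms by (subst card_Diff_subset) auto
  then obtain \<gamma> where \<gamma>: "bij_betw \<gamma> {4..r} (B - {u, v, w})"
    using B' finite_same_card_bij[of "{4..r}" "B - {u, v, w}"] by auto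
  define \<beta> where "\<beta> = \<gamma>(1 := u, 2 := v, 3 := w)"
  have "bij_betw \<beta> {4..r} (B - {u, v, w})"
    using \<gamma> by (subst bij_betw_cong[of _ _ \<gamma>]) (auto simp: \<beta>_def)
  moreover have "bij_betw \<beta> {1, 2, 3} {u, v, w}"
    using assms by (auto simp: \<beta>_def bij_betw_def)
  ultimately have "bij_betw \<beta> ({4..r} \<union> {1, 2, 3}) (B - {u, v, w} \<union> {u, v, w})"
    by (rule bij_betw_combine) auto
  moreover have "{4..r} \<union> {1, 2, 3} = {1..r}" using r by auto
  moreover have "B - {u, v, w} \<union> {u, v, w} = B" using assms by auto
  ultimately have \<beta>: "bij_betw \<beta> {1..r} B" by simp
  interpret B: group "free_group B" by (rule group_free_group)
  let ?\<phi> = "word_value (free_group_rank r) \<circ> lift (free_group B) (\<lambda>x. gen (\<beta> x))"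
  have \<phi>: "?\<phi> \<in> iso (free_group_rank r) (free_group_rank r)"
    using iso_set_trans[OF relabelling_iso[OF \<beta>] h] by (simp add: comp_def compose_def)
  have "?\<phi> (gen x) = \<beta> x" if "x \<in> {1..r}" for x
  proof -
    have "\<beta> x \<in> B" using \<beta> that by (auto simp: bij_betw_def)
    then show ?thesis using BF
      by (auto simp: B.lift_gen gen_closed word_value_eq_lift intro: lift_gen)
  qed
  then have "?\<phi> (gen 1) = u" "?\<phi> (gen 2) = v" "?\<phi> (gen 3) = w"
    using r by (auto simp: \<beta>_def)
  then show ?thesis using \<phi> unfolding basis_triple_def by blast
qed

lemma basis_triple_closed:
  assumes "basis_triple r u v w" "r \<ge> 3"
  shows "u \<in> carrier (free_group_rank r)" "v \<in> carrier (free_group_rank r)"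
    "w \<in> carrier (free_group_rank r)"
proof -
  obtain \<phi> where "\<phi> \<in> hom (free_group_rank r) (free_group_rank r)"
    and "\<phi> (gen 1) = u" "\<phi> (gen 2) = v" "\<phi> (gen 3) = w"
    using assms(1) by (auto simp: basis_triple_def iso_def)
  moreover have "gen x \<in> carrier (free_group_rank r)" if "x \<in> {1, 2, 3}" for x
    using that assms(2) by (intro gen_closed) auto
  ultimately show "u \<in> carrier (free_group_rank r)" "v \<in> carrier (free_group_rank r)"
    "w \<in> carrier (free_group_rank r)"
    using hom_in_carrier by (metis insertCI)+
qed

lemma basis_triple_distinct:
  assumes "basis_triple r u v w" "r \<ge> 3"
  shows "u \<noteq> []" "v \<noteq> []" "w \<noteq> []" "v \<noteq> w"
proof -
  obtain \<phi> where \<phi>: "\<phi> \<in> iso (free_group_rank r) (free_group_rank r)"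
    "\<phi> (gen 1) = u" "\<phi> (gen 2) = v" "\<phi> (gen 3) = w"
    using assms by (auto simp: basis_triple_def)
  then have inj: "inj_on \<phi> (carrier (free_group_rank r))"
    and "\<phi> \<in> hom (free_group_rank r) (free_group_rank r)"
    by (auto simp: iso_def bij_betw_def)
  then have Nil: "\<phi> [] = []"
    using hom_one[of \<phi>] group_free_group by (metis free_group_simps(2))
  have closed: "[] \<in> carrier (free_group_rank r)" "gen x \<in> carrier (free_group_rank r)"
    if "x \<in> {1..r}" for x
    using that by (auto simp: free_group_simps)
  have "\<phi> (gen x) \<noteq> []" if "x \<in> {1..r}" for x
    using inj_onD[OF inj, of "gen x" "[]"] Nil closed that by auto
  moreover have "\<phi> (gen 2) \<noteq> \<phi> (gen 3)"
    using inj_onD[OF inj, of "gen 2" "gen 3"] closed(2)[of 2] closed(2)[of 3] assms(2) by auto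
  ultimately show "u \<noteq> []" "v \<noteq> []" "w \<noteq> []" "v \<noteq> w" using \<phi> assms(2) by auto
qed

text \<open>An automorphism defined on the standard generators is applied before the one that yields
  the triple; this transports each Nielsen move to an arbitrary basis.\<close>

lemma basis_triple_compose:
  assumes "basis_triple r u v w"
    and f: "f \<in> {1..r} \<rightarrow> carrier (free_group_rank r)"
    and iso: "lift (free_group_rank r) f \<in> iso (free_group_rank r) (free_group_rank r)"
    and r: "r \<ge> 3"
  obtains \<phi> where "\<phi> \<in> hom (free_group_rank r) (free_group_rank r)"
    "\<phi> (gen 1) = u" "\<phi> (gen 2) = v" "\<phi> (gen 3) = w"
    "basis_triple r (\<phi> (f 1)) (\<phi> (f 2)) (\<phi> (f 3))"
proof -
  interpret group "free_group_rank r" by (rule group_free_group)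
  obtain \<phi> where \<phi>: "\<phi> \<in> iso (free_group_rank r) (free_group_rank r)"
    "\<phi> (gen 1) = u" "\<phi> (gen 2) = v" "\<phi> (gen 3) = w"
    using assms by (auto simp: basis_triple_def)
  let ?\<psi> = "\<phi> \<circ> lift (free_group_rank r) f"
  have "?\<psi> \<in> iso (free_group_rank r) (free_group_rank r)"
    using iso_set_trans[OF iso \<phi>(1)] by (simp add: comp_def compose_def)
  moreover have "f x \<in> carrier (free_group_rank r)" if "x \<in> {1, 2, 3}" for x
    using that r f by (auto simp: Pi_iff)
  then have "?\<psi> (gen x) = \<phi> (f x)" if "x \<in> {1, 2, 3}" for x
    using that by (simp add: lift_gen)
  ultimately have "basis_triple r (\<phi> (f 1)) (\<phi> (f 2)) (\<phi> (f 3))"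
    unfolding basis_triple_def by blast
  from that[OF _ \<phi>(2-4) this] \<phi>(1) show ?thesis by (simp add: iso_def)
qed

lemma basis_triple_swap:
  assumes "basis_triple r u v w" and r: "r \<ge> 3"
  shows "basis_triple r u w v"
proof -
  let ?\<beta> = "(\<lambda>x. x)(2 := 3, 3 := 2) :: nat \<Rightarrow> nat"
  have "bij_betw ?\<beta> {1..r} {1..r}"
    by (rule bij_betw_byWitness[where f' = ?\<beta>]) (use r in auto)
  then show ?thesis
    using basis_triple_compose[OF assms(1) _ relabelling_iso r, of ?\<beta>] r
    by (fastforce simp: gen_closed bij_betw_def)
qed

lemma basis_triple_inv:
  assumes "basis_triple r u v w" and r: "r \<ge> 3"
  shows "basis_triple r u (inv\<^bsub>free_group_rank r\<^esub> v) w"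
proof -
  interpret group "free_group_rank r" by (rule group_free_group)
  let ?f = "(\<lambda>x. gen x)(2 := inv\<^bsub>free_group_rank r\<^esub> gen 2)"
  have mem: "2 \<in> {1..r}" using r by auto
  have "?f \<in> {1..r} \<rightarrow> carrier (free_group_rank r)"
    using mem by (auto simp: gen_closed)
  then obtain \<phi> where \<phi>: "\<phi> \<in> hom (free_group_rank r) (free_group_rank r)"
    "\<phi> (gen 1) = u" "\<phi> (gen 2) = v" "\<phi> (gen 3) = w"
    "basis_triple r (\<phi> (?f 1)) (\<phi> (?f 2)) (\<phi> (?f 3))"
    by (rule basis_triple_compose[OF assms(1) _ inversion_iso[OF mem] r])
  interpret \<phi>: group_hom "free_group_rank r" "free_group_rank r" \<phi>
    by unfold_locales (rule \<phi>)
  show ?thesis using \<phi> gen_closed[OF mem] by simp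
qed

lemma basis_triple_mult_third:
  assumes "basis_triple r u v w" and r: "r \<ge> 3"
  shows "basis_triple r u v (w \<otimes>\<^bsub>free_group_rank r\<^esub> v)"
proof -
  interpret group "free_group_rank r" by (rule group_free_group)
  let ?f = "(\<lambda>x. gen x)(3 := gen 3 \<otimes>\<^bsub>free_group_rank r\<^esub> gen 2)"
  have mem: "3 \<in> {1..r}" "2 \<in> {1..r}" "3 \<noteq> (2::nat)" using r by auto
  have "?f \<in> {1..r} \<rightarrow> carrier (free_group_rank r)"
    using mem by (auto simp: gen_closed)
  then obtain \<phi> where \<phi>: "\<phi> \<in> hom (free_group_rank r) (free_group_rank r)"
    "\<phi> (gen 1) = u" "\<phi> (gen 2) = v" "\<phi> (gen 3) = w"
    "basis_triple r (\<phi> (?f 1)) (\<phi> (?f 2)) (\<phi> (?f 3))"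
    by (rule basis_triple_compose[OF assms(1) _ transvection_iso[OF mem] r])
  interpret \<phi>: group_hom "free_group_rank r" "free_group_rank r" \<phi>
    by unfold_locales (rule \<phi>)
  show ?thesis using \<phi> gen_closed[OF mem(1)] gen_closed[OF mem(2)] by simp
qed

lemma basis_triple_mult_first:
  assumes "basis_triple r u v w" and r: "r \<ge> 3"
  shows "basis_triple r (u \<otimes>\<^bsub>free_group_rank r\<^esub> w) v w"
proof -
  interpret group "free_group_rank r" by (rule group_free_group)
  let ?f = "(\<lambda>x. gen x)(1 := gen 1 \<otimes>\<^bsub>free_group_rank r\<^esub> gen 3)"
  have mem: "1 \<in> {1..r}" "3 \<in> {1..r}" "1 \<noteq> (3::nat)" using r by auto
  have "?f \<in> {1..r} \<rightarrow> carrier (free_group_rank r)"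
    using mem by (auto simp: gen_closed)
  then obtain \<phi> where \<phi>: "\<phi> \<in> hom (free_group_rank r) (free_group_rank r)"
    "\<phi> (gen 1) = u" "\<phi> (gen 2) = v" "\<phi> (gen 3) = w"
    "basis_triple r (\<phi> (?f 1)) (\<phi> (?f 2)) (\<phi> (?f 3))"
    by (rule basis_triple_compose[OF assms(1) _ transvection_iso[OF mem] r])
  interpret \<phi>: group_hom "free_group_rank r" "free_group_rank r" \<phi>
    by unfold_locales (rule \<phi>)
  show ?thesis using \<phi> gen_closed[OF mem(1)] gen_closed[OF mem(2)] by simp
qed

lemma basis_triple_div_third:
  assumes "basis_triple r u v w" and r: "r \<ge> 3"
  shows "basis_triple r u v (w \<otimes>\<^bsub>free_group_rank r\<^esub> inv\<^bsub>free_group_rank r\<^esub> v)"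
proof -
  interpret group "free_group_rank r" by (rule group_free_group)
  have "basis_triple r u (inv\<^bsub>free_group_rank r\<^esub> (inv\<^bsub>free_group_rank r\<^esub> v))
      (w \<otimes>\<^bsub>free_group_rank r\<^esub> inv\<^bsub>free_group_rank r\<^esub> v)"
    by (intro basis_triple_inv basis_triple_mult_third assms)
  then show ?thesis using basis_triple_closed[OF assms] by simp
qed

lemma basis_triple_act:
  assumes "basis_triple r u v w" and r: "r \<ge> 3"
  shows "basis_triple r u v (act v w)"
proof -
  interpret group "free_group_rank r" by (rule group_free_group)
  let ?i = "\<lambda>x. inv\<^bsub>free_group_rank r\<^esub> x"
  \<comment> \<open>Left multiplication comes from right division: invert the third element, divide
    it by \<open>v\<close>, and invert the result.\<close>
  have "basis_triple r u v (?i (?i w \<otimes>\<^bsub>free_group_rank r\<^esub> ?i v))"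
    by (intro basis_triple_div_third basis_triple_swap[OF basis_triple_inv[OF basis_triple_swap]]
      assms)
  moreover have "?i (?i w \<otimes>\<^bsub>free_group_rank r\<^esub> ?i v) = v \<otimes>\<^bsub>free_group_rank r\<^esub> w"
    using basis_triple_closed[OF assms] by (simp add: inv_mult_group)
  ultimately show ?thesis using basis_triple_closed[OF assms] by (simp add: mult_free_group)
qed

lemma basis_triple_act_power:
  assumes "basis_triple r u v w" and r: "r \<ge> 3"
  shows "basis_triple r u v (act (concat (replicate k v)) w)"
  by (induction k) (auto intro: basis_triple_act assms)

section \<open>Controlling the first and last letters\<close>

text \<open>The second assumption rules out cancellation at the seams between consecutive copies of
  \<open>v\<close>.\<close>

lemma freely_reduced_power:
  assumes "freely_reduced v" "hd v \<noteq> inv_letter (last v)"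
  shows "freely_reduced (concat (replicate k v))"
proof (induction k)
  case (Suc k)
  then show ?case
    using assms by (cases k; cases "v = []") (auto simp: freely_reduced_append)
qed simp

text \<open>A Euclidean algorithm: as long as one of the two words is a suffix of the other, that suffix
  is divided off; otherwise the quotient of the two words has the required ends.\<close>

lemma basis_triple_remove_suffix:
  assumes "basis_triple r u v w" and r: "r \<ge> 3"
    and "hd v \<noteq> p" "last v = inv_letter p" "hd w \<noteq> p" "last w = inv_letter p"
  shows "\<exists>v' w'. basis_triple r u v' w' \<and> hd w' \<noteq> p \<and> last w' \<noteq> inv_letter p"
  using assms
proof (induction "length v + length w" arbitrary: v w rule: less_induct)
  case less
  interpret group "free_group_rank r" by (rule group_free_group)
  \<comment> \<open>Stated for fresh \<open>b\<close> and \<open>c\<close> so that, after a swap, it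
    serves whichever word is the suffix.\<close>
  have suffix_case: ?case
    if T: "basis_triple r u b c" and len: "length b + length c = length v + length w"
      and ends: "hd b \<noteq> p" "last b = inv_letter p" "hd c \<noteq> p"
      and suffix: "suffix b c" for b c
  proof -
    obtain d where d: "c = d @ b" using suffix by (auto simp: suffix_def)
    \<comment> \<open>Distinctness of the basis elements makes the quotient \<open>d\<close>
      nonempty, so it inherits the first letter of \<open>c\<close>.\<close>
    have "b \<noteq> []" "b \<noteq> c" "b \<in> carrier (free_group_rank r)" "c \<in> carrier (free_group_rank r)"
      using basis_triple_distinct[OF T r] basis_triple_closed[OF T r] by auto
    moreover from this have "d \<in> carrier (free_group_rank r)" "d \<noteq> []"
      using d by (auto simp: free_group_simps freely_reduced_append)
    moreover have "c = d \<otimes>\<^bsub>free_group_rank r\<^esub> b"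
      using d calculation by (simp add: mult_free_group_append free_group_simps)
    ultimately have "basis_triple r u b d"
      using basis_triple_div_third[OF T r] by (simp add: m_assoc)
    moreover have "hd d \<noteq> p" using ends d \<open>d \<noteq> []\<close> by simp
    moreover have "length b + length d < length v + length w"
      using len d \<open>b \<noteq> []\<close> by (cases b) auto
    \<comment> \<open>If \<open>d\<close> ends with the inverse of \<open>p\<close>, the induction
      hypothesis applies to \<open>b\<close> and \<open>d\<close>; otherwise \<open>d\<close> is
      already as required.\<close>
    ultimately show ?thesis using less.hyps[of b d] ends r by blast
  qed
  consider "suffix v w" | "suffix w v" | "rev v \<parallel> rev w"
    unfolding suffix_to_prefix by (auto simp: parallel_def)
  then show ?case
  proof cases
    case 1
    then show ?thesis using suffix_case[of v w] less.prems by simp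
  next
    case 2
    then show ?thesis using suffix_case[OF basis_triple_swap] less.prems by simp
  next
    case 3
    then obtain as x bs y cs where *: "x \<noteq> y" "rev v = as @ x # bs" "rev w = as @ y # cs"
      using parallel_decomp by blast
    \<comment> \<open>Here \<open>s\<close> is the longest common suffix. Since \<open>b\<close> and
      \<open>c\<close> end in different letters, \<open>b @ inv_word c\<close> is reduced, and it is
      the quotient of \<open>v\<close> by \<open>w\<close>.\<close>
    define s b c where "s = rev as" and "b = rev bs @ [x]" and "c = rev cs @ [y]"
    have vw: "v = b @ s" "w = c @ s"
      using arg_cong[OF *(2), of rev] arg_cong[OF *(3), of rev] by (auto simp: s_def b_def c_def)
    have closed: "v \<in> carrier (free_group_rank r)" "w \<in> carrier (free_group_rank r)"
      using basis_triple_closed[OF less.prems(1) r] by auto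
    then have closed': "b \<in> carrier (free_group_rank r)" "s \<in> carrier (free_group_rank r)"
      "c \<in> carrier (free_group_rank r)"
      using vw by (auto simp: free_group_simps freely_reduced_append)
    have ne: "b \<noteq> []" "c \<noteq> []" "last b \<noteq> last c" using * by (auto simp: b_def c_def)
    then have red: "freely_reduced (b @ inv_word c)"
      using closed'
      by (auto simp: freely_reduced_append free_group_simps freely_reduced_inv_word hd_inv_word)
    have "v = b \<otimes>\<^bsub>free_group_rank r\<^esub> s" "w = c \<otimes>\<^bsub>free_group_rank r\<^esub> s"
      using vw closed by (auto simp: mult_free_group_append free_group_simps)
    moreover have "s \<otimes>\<^bsub>free_group_rank r\<^esub>
        (inv\<^bsub>free_group_rank r\<^esub> s \<otimes>\<^bsub>free_group_rank r\<^esub> inv\<^bsub>free_group_rank r\<^esub> c)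
      = inv\<^bsub>free_group_rank r\<^esub> c"
      using closed' by (simp add: m_assoc[symmetric])
    ultimately have "v \<otimes>\<^bsub>free_group_rank r\<^esub> inv\<^bsub>free_group_rank r\<^esub> w
      = b \<otimes>\<^bsub>free_group_rank r\<^esub> inv\<^bsub>free_group_rank r\<^esub> c"
      using closed' by (simp add: inv_mult_group m_assoc)
    also have "\<dots> = b @ inv_word c"
      using closed' red by (simp add: mult_free_group_append inv_free_group)
    finally have "v \<otimes>\<^bsub>free_group_rank r\<^esub> inv\<^bsub>free_group_rank r\<^esub> w = b @ inv_word c" .
    then have "basis_triple r u w (b @ inv_word c)"
      using basis_triple_div_third[OF basis_triple_swap[OF less.prems(1) r] r] by simp
    \<comment> \<open>The quotient begins like \<open>v\<close> and ends with the inverse of the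
      first letter of \<open>w\<close>; neither of these first letters is \<open>p\<close>.\<close>
    moreover have "hd (b @ inv_word c) = hd v" "last (b @ inv_word c) = inv_letter (hd w)"
      using vw ne by (simp_all add: last_inv_word)
    ultimately show ?thesis using less.prems by (metis inv_letter_eq_iff)
  qed
qed

section \<open>Completing \<open>w\<close> to a cyclically reduced primitive word\<close>

text \<open>The condition on the first letter of \<open>d\<close> prevents cancellation at the seam
  of \<open>w @ d\<close>, the one on its last letter prevents cyclic cancellation, and a
  transvection makes \<open>w @ d\<close> primitive.\<close>

lemma exists_automorphism_containing:
  assumes T: "basis_triple r w b d" and r: "r \<ge> 3"
    and w: "last w = inv_letter (hd w)" and d: "hd d \<noteq> hd w" "last d \<noteq> inv_letter (hd w)"
  shows "\<exists>\<phi> \<in> iso (free_group_rank r) (free_group_rank r).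
    sublist w (cyclic_reduction (\<phi> [(1, True)]))"
proof -
  note closed = basis_triple_closed[OF T r] and distinct = basis_triple_distinct[OF T r]
  have "freely_reduced (w @ d)"
    using closed w d by (auto simp: freely_reduced_append free_group_simps)
  then have "basis_triple r (w @ d) b d"
    using basis_triple_mult_first[OF T r] by (simp add: mult_free_group_append)
  then obtain \<phi> where "\<phi> \<in> iso (free_group_rank r) (free_group_rank r)" "\<phi> (gen 1) = w @ d"
    by (auto simp: basis_triple_def)
  moreover have "cyclic_reduction (w @ d) = w @ d"
    using distinct d by (subst cyclic_reduction.simps) auto
  ultimately show ?thesis by (metis sublist_appendI append_Nil)
qed

lemma free_basis_element_in_cyclic_reduction:
  assumes r: "r \<ge> 3" and B: "free_basis (free_group_rank r) B" and red: "weakly_reduced r B"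
    and w: "w \<in> B"
  shows "\<exists>\<phi> \<in> iso (free_group_rank r) (free_group_rank r).
    sublist w (cyclic_reduction (\<phi> [(1, True)]))"
proof -
  interpret group "free_group_rank r" by (rule group_free_group)
  have "card B = r"
    using B card_eq_if_iso_free_group[of _ B "{1..r}"] by (auto simp: free_basis_def)
  then have third: "\<exists>c \<in> B. c \<noteq> w \<and> c \<noteq> b" for b
    using r card_mono[of "{w, b}" B] card_insert_le_m1[of 2 "{b}" w] by fastforce
  \<comment> \<open>This preliminary triple shows that \<open>w\<close> is primitive and nonempty;
    the triple used in the main case is chosen once \<open>p\<close> is known.\<close>
  then obtain b0 c0 where "b0 \<in> B" "b0 \<noteq> w" "c0 \<in> B" "c0 \<noteq> w" "c0 \<noteq> b0" by metis
  then have T0: "basis_triple r w b0 c0"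
    using basis_triple_of_free_basis[OF r B] w by metis
  have w_ne: "w \<noteq> []" and w_closed: "w \<in> carrier (free_group_rank r)"
    using basis_triple_distinct[OF T0 r] basis_triple_closed[OF T0 r] by auto
  show ?thesis
  proof (cases "last w = inv_letter (hd w)")
    case False
    then have "cyclic_reduction w = w" by (subst cyclic_reduction.simps) auto
    then show ?thesis using T0 by (force simp: basis_triple_def)
  next
    case True
    define p where "p = hd w"
    have "p \<in> {1..r} \<times> UNIV"
      using w_ne w_closed by (cases w; cases p) (auto simp: p_def free_group_simps)
    then obtain b where b: "b \<in> B" "\<not> (prefix [p] b \<and> suffix [inv_letter p] b)"
      using red unfolding weakly_reduced_def by blast
    have "prefix [p] w" "suffix [inv_letter p] w"
      using w_ne True by (cases w, auto simp: p_def) (metis append_butlast_last_id suffixI)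
    then have "b \<noteq> w" using b by auto
    obtain c where c: "c \<in> B" "c \<noteq> w" "c \<noteq> b" using third by blast
    have T: "basis_triple r w b c"
      using basis_triple_of_free_basis[OF r B] w b c \<open>b \<noteq> w\<close> by metis
    note b_ne = basis_triple_distinct(2)[OF T r] and b_closed = basis_triple_closed(2)[OF T r]
    have "hd b \<noteq> p \<or> last b \<noteq> inv_letter p"
    proof (rule ccontr)
      assume "\<not> (hd b \<noteq> p \<or> last b \<noteq> inv_letter p)"
      then have "prefix [p] b" "suffix [inv_letter p] b"
        using b_ne by (cases b, auto) (metis append_butlast_last_id suffixI)
      then show False using b by blast
    qed
    \<comment> \<open>Take \<open>b\<close> itself if it does not begin with \<open>p\<close>, and
      its inverse if it does not end with the inverse of \<open>p\<close>.\<close>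
    then obtain v where T': "basis_triple r w v c" and v: "hd v \<noteq> p"
    proof
      assume "last b \<noteq> inv_letter p"
      then have "hd (inv_word b) \<noteq> p"
        using hd_inv_word[OF b_ne] by (metis inv_letter_inv_letter)
      then show thesis
        using that basis_triple_inv[OF T r] inv_free_group[OF b_closed] by metis
    qed (use that T in blast)
    note v_ne = basis_triple_distinct(2)[OF T' r] and v_closed = basis_triple_closed(2)[OF T' r]
      and c_closed = basis_triple_closed(3)[OF T' r]
    have "\<exists>v' d. basis_triple r w v' d \<and> hd d \<noteq> p \<and> last d \<noteq> inv_letter p"
    proof (cases "last v = inv_letter p")
      case False
      then show ?thesis using basis_triple_swap[OF T' r] v by blast
    next
      case last_v: True
      text \<open>Now \<open>v\<close> is cyclically reduced, so that multiplying by a high power of it on the left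
        fixes the first letter.\<close>
      let ?v = "concat (replicate (Suc (length c)) v)"
      let ?d = "act ?v c"
      have "freely_reduced ?v"
        using v_closed v last_v by (intro freely_reduced_power) (auto simp: free_group_simps)
      \<comment> \<open>As \<open>v\<close> is nonempty, \<open>length c + 1\<close> copies of it
        are longer than \<open>c\<close>, as \<open>hd_act\<close> requires.\<close>
      moreover have "length c < length ?v"
      proof -
        have "length ?v = Suc (length c) * length v"
          by (simp add: length_concat sum_list_replicate)
        moreover have "length c < Suc (length c) * length v" using v_ne by (cases v) auto
        ultimately show ?thesis by (simp only:)
      qed
      ultimately have "hd ?d = hd ?v"
        using hd_act[of ?v c] c_closed unfolding free_group_simps by blast
      then have d: "hd ?d \<noteq> p" using v v_ne by simp
      have Td: "basis_triple r w v ?d" by (rule basis_triple_act_power[OF T' r])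
      \<comment> \<open>Either the new element already has the right last letter, or both words end
        with the inverse of \<open>p\<close> and the Euclidean algorithm applies.\<close>
      show ?thesis
        using basis_triple_remove_suffix[OF Td r v last_v d] Td d by blast
    qed
    then show ?thesis
      using exists_automorphism_containing r True unfolding p_def by metis
  qed
qed

theorem lemma3p5:
  fixes r :: nat and B :: "nat letter list set" and w :: "nat letter list"
  assumes "r \<ge> 3"
    and "free_basis (free_group_rank r) B"
    and "weakly_reduced r B"
    and "w \<in> B"
  shows "\<not> (\<exists>v. sublist v w \<and> primitivity_blocking r v)"
  using free_basis_element_in_cyclic_reduction[OF assms]
  by (auto simp: primitivity_blocking_def intro: sublist_order.order.trans)

end
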